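(* Let $G,H$ be three-player impartial games with $\mathbf O\notin o(G)$ and $\mathbf O\notin o(H)$. Then $\mathbf P\notin o(G+H)$.
   Context: All games are short impartial games (identified with the finite set of their options, no infinite runs); $G+H$ is the disjunctive sum. Three players move in turn; under normal play the player unable to move on their turn is the unique loser. The outcome $o(G)\subseteq\{\mathbf N,\mathbf O,\mathbf P\}$ (Next, Other, Previous) is defined recursively: $\mathbf N\in o(G)$ iff some option $G'$ has $\mathbf P\in o(G')$; $\mathbf O\in o(G)$ iff every option $G'$ has $\mathbf N\in o(G')$; $\mathbf P\in o(G)$ iff every option $G'$ has $\mathbf O\in o(G')$. *)

theory Defs
  imports Main "HOL-Library.FSet"
begin

datatype game = Game (options: "game fset")

lemma size_option_less: "G' |\<in>| options G \<Longrightarrow> size G' < size G"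
proof (cases G)
  case (Game X)
  assume "G' |\<in>| options G"
  with Game have "G' |\<in>| X" by simp
  then have "Suc (size G') \<le> (\<Sum>x\<in>fset X. Suc (size x))"
    by (intro member_le_sum) auto
  with Game show ?thesis by simp
qed

instantiation game :: plus
begin

function plus_game :: "game \<Rightarrow> game \<Rightarrow> game" where
  "plus_game G H =
     Game ((\<lambda>G'. plus_game G' H) |`| options G |\<union>| (\<lambda>H'. plus_game G H') |`| options H)"
  by pat_completeness auto
termination
  by (relation "measure (\<lambda>(G, H). size G + size H)") (auto dest: size_option_less)

instance ..

end

declare plus_game.simps [simp del]

lemma options_plus:
  "options (G + H) = (\<lambda>G'. G' + H) |`| options G |\<union>| (\<lambda>H'. G + H') |`| options H"
  by (subst plus_game.simps) simp

text \<open>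
  Players are named by their position relative to the current turn. After a move they
  are renamed: the player who moved (Next) becomes Previous, Other becomes Next and
  Previous becomes Other. A player belongs to the outcome iff they can make sure not to
  be the unique loser, whatever the other two do.
\<close>

datatype player = Next | Other | Previous

function outcome :: "game \<Rightarrow> player set" where
  "outcome G = {p. case p of
       Next \<Rightarrow> (\<exists>G'|\<in>|options G. Previous \<in> outcome G')
     | Other \<Rightarrow> (\<forall>G'|\<in>|options G. Next \<in> outcome G')
     | Previous \<Rightarrow> (\<forall>G'|\<in>|options G. Other \<in> outcome G')}"
  by pat_completeness auto
termination
  by (relation "measure size") (auto dest: size_option_less)

declare outcome.simps [simp del]

lemma Next_in_outcome_iff: "Next \<in> outcome G \<longleftrightarrow> (\<exists>G'. G' |\<in>| options G \<and> Previous \<in> outcome G')"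
  by (subst outcome.simps) auto

lemma Other_in_outcome_iff: "Other \<in> outcome G \<longleftrightarrow> (\<forall>G'. G' |\<in>| options G \<longrightarrow> Next \<in> outcome G')"
  by (subst outcome.simps) auto

lemma Previous_in_outcome_iff: "Previous \<in> outcome G \<longleftrightarrow> (\<forall>G'. G' |\<in>| options G \<longrightarrow> Other \<in> outcome G')"
  by (subst outcome.simps) auto

end

(* Regard the two players other than a fixed victim as a coalition. A position with the victim to
   move is lost for the victim iff every move of the victim has an answer, consisting of two
   successive coalition moves, that leads to such a position again. In a sum of two such positions
   the coalition answers in the component just played in, so the sum is lost for the victim as
   well. If the coalition has only one move before the victim's turn in each of G and H, in G + H
   with two moves to spend it makes one of these in each component. *)

theory Submission
  imports Defs
begin

lemma options_plusI1: "G' |\<in>| options G \<Longrightarrow> G' + H |\<in>| options (G + H)"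
  by (auto simp: options_plus)

lemma options_plusI2: "H' |\<in>| options H \<Longrightarrow> G + H' |\<in>| options (G + H)"
  by (auto simp: options_plus)

lemma options_plusE:
  assumes "X |\<in>| options (G + H)"
  obtains G' where "G' |\<in>| options G" "X = G' + H"
    | H' where "H' |\<in>| options H" "X = G + H'"
  using assms by (auto simp: options_plus)

text \<open>Unfolds two turns: with the victim moving third, the coalition picks both moves, after
  which the victim is named \<open>Next\<close>.\<close>

lemma Previous_notin_outcome_iff:
  "Previous \<notin> outcome G \<longleftrightarrow>
     (\<exists>G' G''. G' |\<in>| options G \<and> G'' |\<in>| options G' \<and> Next \<notin> outcome G'')"
  by (auto simp: Previous_in_outcome_iff Other_in_outcome_iff)

lemma Next_notin_outcome_plus:
  assumes "Next \<notin> outcome G" and "Next \<notin> outcome H"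
  shows "Next \<notin> outcome (G + H)"
  using assms
proof (induction "size G + size H" arbitrary: G H rule: less_induct)
  case less
  have "Previous \<notin> outcome X" if "X |\<in>| options (G + H)" for X
    using that
  proof (cases rule: options_plusE)
    case (1 G1)
    then have "Previous \<notin> outcome G1"
      using less.prems(1) Next_in_outcome_iff by blast
    then obtain G2 G3 where G: "G2 |\<in>| options G1" "G3 |\<in>| options G2" "Next \<notin> outcome G3"
      unfolding Previous_notin_outcome_iff by blast
    \<comment> \<open>All three moves were made in \<open>G\<close> and \<open>H\<close> is
      untouched, so the measure drops.\<close>
    have "size G3 < size G"
      using 1 G size_option_less less_trans by metis
    then have "Next \<notin> outcome (G3 + H)"
      using less.hyps less.prems(2) G(3) by simp
    then show ?thesis
      unfolding Previous_notin_outcome_iff 1 using G options_plusI1 by blast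
  next
    case (2 H1)
    then have "Previous \<notin> outcome H1"
      using less.prems(2) Next_in_outcome_iff by blast
    then obtain H2 H3 where H: "H2 |\<in>| options H1" "H3 |\<in>| options H2" "Next \<notin> outcome H3"
      unfolding Previous_notin_outcome_iff by blast
    have "size H3 < size H"
      using 2 H size_option_less less_trans by metis
    then have "Next \<notin> outcome (G + H3)"
      using less.hyps less.prems(1) H(3) by simp
    then show ?thesis
      unfolding Previous_notin_outcome_iff 2 using H options_plusI2 by blast
  qed
  then show ?case
    by (auto simp: Next_in_outcome_iff)
qed

theorem mainTheorem5:
  fixes G H :: game
  assumes "Other \<notin> outcome G"
    and "Other \<notin> outcome H"
  shows "Previous \<notin> outcome (G + H)"
proof -
  obtain G' where G': "G' |\<in>| options G" "Next \<notin> outcome G'"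
    using assms(1) Other_in_outcome_iff by blast
  obtain H' where H': "H' |\<in>| options H" "Next \<notin> outcome H'"
    using assms(2) Other_in_outcome_iff by blast
  have "Next \<notin> outcome (G' + H')"
    using G'(2) H'(2) by (rule Next_notin_outcome_plus)
  then show ?thesis
    unfolding Previous_notin_outcome_iff
    \<comment> \<open>Both facts are schematic in the other summand, so they chain into a path such
      as \<open>G + H\<close>, \<open>G' + H\<close>, \<open>G' + H'\<close>.\<close>
    using options_plusI1[OF G'(1)] options_plusI2[OF H'(1)] by blast
qed

end
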